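(* Let $G$ be an acylindrically hyperbolic group which has no non-trivial finite normal subgroup. Then $G$ is a domain.
   Context: A group $G$ is called a domain if for all $x, y \in G$ with $x \neq e$ and $y \neq e$ there exists $g \in G$ such that $[x, g y g^{-1}] \neq e$, where $[u,v]=uvu^{-1}v^{-1}$ denotes the commutator. *)

theory Defs
  imports "HOL-Analysis.Abstract_Metric_Spaces" "HOL-Algebra.Coset"
begin

definition commutator :: "('a, 'm) monoid_scheme \<Rightarrow> 'a \<Rightarrow> 'a \<Rightarrow> 'a" where
  "commutator G u v = u \<otimes>\<^bsub>G\<^esub> v \<otimes>\<^bsub>G\<^esub> inv\<^bsub>G\<^esub> u \<otimes>\<^bsub>G\<^esub> inv\<^bsub>G\<^esub> v"

definition is_domain_group :: "('a, 'm) monoid_scheme \<Rightarrow> bool" where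
  "is_domain_group G \<longleftrightarrow>
     (\<forall>x\<in>carrier G. \<forall>y\<in>carrier G. x \<noteq> \<one>\<^bsub>G\<^esub> \<longrightarrow> y \<noteq> \<one>\<^bsub>G\<^esub> \<longrightarrow>
        (\<exists>g\<in>carrier G. commutator G x (g \<otimes>\<^bsub>G\<^esub> y \<otimes>\<^bsub>G\<^esub> inv\<^bsub>G\<^esub> g) \<noteq> \<one>\<^bsub>G\<^esub>))"

definition no_nontrivial_finite_normal :: "('a, 'm) monoid_scheme \<Rightarrow> bool" where
  "no_nontrivial_finite_normal G \<longleftrightarrow>
     (\<forall>N. N \<lhd> G \<and> finite N \<longrightarrow> N = {\<one>\<^bsub>G\<^esub>})"

definition gromov_product :: "('b \<Rightarrow> 'b \<Rightarrow> real) \<Rightarrow> 'b \<Rightarrow> 'b \<Rightarrow> 'b \<Rightarrow> real" where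
  "gromov_product d w x y = (d x w + d y w - d x y) / 2"

definition geodesic_space :: "'b set \<Rightarrow> ('b \<Rightarrow> 'b \<Rightarrow> real) \<Rightarrow> bool" where
  "geodesic_space M d \<longleftrightarrow> Metric_space M d \<and>
     (\<forall>x\<in>M. \<forall>y\<in>M. \<exists>\<gamma>::real \<Rightarrow> 'b. \<gamma> 0 = x \<and> \<gamma> (d x y) = y \<and>
        (\<forall>s\<in>{0..d x y}. \<forall>t\<in>{0..d x y}. \<gamma> s \<in> M \<and> d (\<gamma> s) (\<gamma> t) = \<bar>s - t\<bar>))"

definition hyperbolic_space :: "'b set \<Rightarrow> ('b \<Rightarrow> 'b \<Rightarrow> real) \<Rightarrow> bool" where
  "hyperbolic_space M d \<longleftrightarrow> geodesic_space M d \<and>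
     (\<exists>\<delta>\<ge>0. \<forall>w\<in>M. \<forall>x\<in>M. \<forall>y\<in>M. \<forall>z\<in>M.
        gromov_product d w x z \<ge> min (gromov_product d w x y) (gromov_product d w y z) - \<delta>)"

definition isometric_action ::
  "('a, 'm) monoid_scheme \<Rightarrow> 'b set \<Rightarrow> ('b \<Rightarrow> 'b \<Rightarrow> real) \<Rightarrow> ('a \<Rightarrow> 'b \<Rightarrow> 'b) \<Rightarrow> bool" where
  "isometric_action G M d \<phi> \<longleftrightarrow>
     (\<forall>g\<in>carrier G. \<phi> g ` M = M \<and> (\<forall>x\<in>M. \<forall>y\<in>M. d (\<phi> g x) (\<phi> g y) = d x y)) \<and>
     (\<forall>x\<in>M. \<phi> \<one>\<^bsub>G\<^esub> x = x) \<and>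
     (\<forall>g\<in>carrier G. \<forall>h\<in>carrier G. \<forall>x\<in>M. \<phi> (g \<otimes>\<^bsub>G\<^esub> h) x = \<phi> g (\<phi> h x))"

definition acylindrical_action ::
  "('a, 'm) monoid_scheme \<Rightarrow> 'b set \<Rightarrow> ('b \<Rightarrow> 'b \<Rightarrow> real) \<Rightarrow> ('a \<Rightarrow> 'b \<Rightarrow> 'b) \<Rightarrow> bool" where
  "acylindrical_action G M d \<phi> \<longleftrightarrow>
     (\<forall>\<epsilon>>0. \<exists>R N::nat. \<forall>x\<in>M. \<forall>y\<in>M. d x y \<ge> R \<longrightarrow>
        finite {g\<in>carrier G. d x (\<phi> g x) \<le> \<epsilon> \<and> d y (\<phi> g y) \<le> \<epsilon>} \<and>
        card {g\<in>carrier G. d x (\<phi> g x) \<le> \<epsilon> \<and> d y (\<phi> g y) \<le> \<epsilon>} \<le> N)"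

definition converges_at_infinity :: "('b \<Rightarrow> 'b \<Rightarrow> real) \<Rightarrow> 'b \<Rightarrow> (nat \<Rightarrow> 'b) \<Rightarrow> bool" where
  "converges_at_infinity d p a \<longleftrightarrow>
     (\<forall>K. \<exists>N0. \<forall>m\<ge>N0. \<forall>n\<ge>N0. gromov_product d p (a m) (a n) \<ge> K)"

definition same_boundary_point :: "('b \<Rightarrow> 'b \<Rightarrow> real) \<Rightarrow> 'b \<Rightarrow> (nat \<Rightarrow> 'b) \<Rightarrow> (nat \<Rightarrow> 'b) \<Rightarrow> bool" where
  "same_boundary_point d p a b \<longleftrightarrow>
     (\<forall>K. \<exists>N0. \<forall>m\<ge>N0. \<forall>n\<ge>N0. gromov_product d p (a m) (b n) \<ge> K)"

text \<open>Non-elementary: the limit set (accumulation points in the Gromov boundary of an orbit)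
  contains more than two points.\<close>
definition nonelementary_action ::
  "('a, 'm) monoid_scheme \<Rightarrow> 'b set \<Rightarrow> ('b \<Rightarrow> 'b \<Rightarrow> real) \<Rightarrow> ('a \<Rightarrow> 'b \<Rightarrow> 'b) \<Rightarrow> bool" where
  "nonelementary_action G M d \<phi> \<longleftrightarrow>
     (\<exists>p\<in>M. \<exists>a b c :: nat \<Rightarrow> 'a.
        range a \<subseteq> carrier G \<and> range b \<subseteq> carrier G \<and> range c \<subseteq> carrier G \<and>
        converges_at_infinity d p (\<lambda>n. \<phi> (a n) p) \<and>
        converges_at_infinity d p (\<lambda>n. \<phi> (b n) p) \<and>
        converges_at_infinity d p (\<lambda>n. \<phi> (c n) p) \<and>
        \<not> same_boundary_point d p (\<lambda>n. \<phi> (a n) p) (\<lambda>n. \<phi> (b n) p) \<and>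
        \<not> same_boundary_point d p (\<lambda>n. \<phi> (a n) p) (\<lambda>n. \<phi> (c n) p) \<and>
        \<not> same_boundary_point d p (\<lambda>n. \<phi> (b n) p) (\<lambda>n. \<phi> (c n) p))"

text \<open>A non-elementary acylindrical isometric action of G on a hyperbolic space (M,d).
  G is acylindrically hyperbolic iff such an action exists on some space; in the theorem the
  carrier type of the space is a free (hence universally quantified) type variable.\<close>
definition acyl_hyp_action ::
  "('a, 'm) monoid_scheme \<Rightarrow> 'b set \<Rightarrow> ('b \<Rightarrow> 'b \<Rightarrow> real) \<Rightarrow> ('a \<Rightarrow> 'b \<Rightarrow> 'b) \<Rightarrow> bool" where
  "acyl_hyp_action G M d \<phi> \<longleftrightarrow>
     hyperbolic_space M d \<and> isometric_action G M d \<phi> \<and>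
     acylindrical_action G M d \<phi> \<and> nonelementary_action G M d \<phi>"

end

theory Submission
  imports Defs
begin

text \<open>If \<open>x\<close> commutes with all conjugates of \<open>y\<close>, then \<open>G\<close> has two nontrivial, hence infinite, normal
  subgroups \<open>C \<ni> x\<close> and \<open>N \<ni> y\<close> commuting with each other. By acylindricity an infinite normal
  subgroup has unbounded orbits; applied to \<open>C\<close>, this bounds the number of elements of \<open>N\<close> with
  small displacement, as \<open>n \<in> N\<close> moves all points of an orbit of \<open>C\<close> equally far. Since the
  conjugates of enough elements of \<open>N\<close> by a far-moving \<open>g\<close> cannot all have small displacement, one
  of them moves \<open>p\<close> far in the direction of \<open>g p\<close>. Hence the orbit \<open>N p\<close> approaches three distinct
  limit points of \<open>G\<close>. An element of \<open>C\<close> moves all points of \<open>N p\<close> equally far, so it coarsely fixes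
  the three limit points and therefore their centre, which is near \<open>p\<close>. Thus \<open>C\<close> has bounded
  orbits, a contradiction.\<close>

section \<open>Centralizers and their normality\<close>

definition centralizer :: "('a, 'm) monoid_scheme \<Rightarrow> 'a set \<Rightarrow> 'a set" where
  "centralizer G S = {g \<in> carrier G. \<forall>s\<in>S. g \<otimes>\<^bsub>G\<^esub> s = s \<otimes>\<^bsub>G\<^esub> g}"

context group
begin

lemma centralizer_subgroup:
  assumes "S \<subseteq> carrier G"
  shows "subgroup (centralizer G S) G"
proof
  show "centralizer G S \<subseteq> carrier G"
    by (auto simp: centralizer_def)
  show "\<one> \<in> centralizer G S"
    using assms by (auto simp: centralizer_def)
next
  fix a b assume a: "a \<in> centralizer G S" and b: "b \<in> centralizer G S"
  have "a \<otimes> b \<otimes> s = s \<otimes> (a \<otimes> b)" if "s \<in> S" for s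
  proof -
    have s: "s \<in> carrier G" using that assms by blast
    have ab: "a \<in> carrier G" "b \<in> carrier G" "a \<otimes> s = s \<otimes> a" "b \<otimes> s = s \<otimes> b"
      using a b that by (auto simp: centralizer_def)
    then show ?thesis using s by (metis m_assoc)
  qed
  then show "a \<otimes> b \<in> centralizer G S"
    using a b by (auto simp: centralizer_def)
next
  fix a assume a: "a \<in> centralizer G S"
  have "inv a \<otimes> s = s \<otimes> inv a" if "s \<in> S" for s
  proof -
    have s: "s \<in> carrier G" using that assms by blast
    have aa: "a \<in> carrier G" "a \<otimes> s = s \<otimes> a"
      using a that by (auto simp: centralizer_def)
    have "inv a \<otimes> s = inv a \<otimes> (s \<otimes> a) \<otimes> inv a"
      using aa s by (simp add: m_assoc)
    also have "\<dots> = inv a \<otimes> (a \<otimes> s) \<otimes> inv a" using aa by simp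
    also have "\<dots> = s \<otimes> inv a" using aa(1) s by (simp add: m_assoc[symmetric])
    finally show ?thesis .
  qed
  then show "inv a \<in> centralizer G S"
    using a by (auto simp: centralizer_def)
qed

lemma conj_commute:
  assumes "g \<in> carrier G" "a \<in> carrier G" "s \<in> carrier G"
    and "a \<otimes> (inv g \<otimes> s \<otimes> g) = (inv g \<otimes> s \<otimes> g) \<otimes> a"
  shows "(g \<otimes> a \<otimes> inv g) \<otimes> s = s \<otimes> (g \<otimes> a \<otimes> inv g)"
proof -
  have "(g \<otimes> a \<otimes> inv g) \<otimes> s = g \<otimes> (a \<otimes> (inv g \<otimes> s \<otimes> g)) \<otimes> inv g"
    using assms(1-3) by (simp add: m_assoc)
  also have "\<dots> = g \<otimes> ((inv g \<otimes> s \<otimes> g) \<otimes> a) \<otimes> inv g"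
    by (simp only: assms(4))
  also have "\<dots> = (g \<otimes> inv g) \<otimes> (s \<otimes> (g \<otimes> a \<otimes> inv g))"
    using assms(1-3) by (simp only: m_assoc m_closed inv_closed)
  finally show ?thesis using assms(1-3) by simp
qed

text \<open>Conjugation by \<open>inv g\<close> maps \<open>S\<close> into itself, so
  \<open>conj_commute\<close> transfers commutation with \<open>S\<close> from \<open>a\<close> to
  its conjugate. The theorem applies this to the conjugates of \<open>y\<close>, then to the
  centralizer so obtained.\<close>

lemma centralizer_normal:
  assumes S: "S \<subseteq> carrier G"
    and conj: "\<And>g s. g \<in> carrier G \<Longrightarrow> s \<in> S \<Longrightarrow> g \<otimes> s \<otimes> inv g \<in> S"
  shows "centralizer G S \<lhd> G"
  unfolding normal_inv_iff
proof (intro conjI ballI)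
  show "subgroup (centralizer G S) G" using S by (rule centralizer_subgroup)
next
  fix g a assume g: "g \<in> carrier G" and a: "a \<in> centralizer G S"
  have "(g \<otimes> a \<otimes> inv g) \<otimes> s = s \<otimes> (g \<otimes> a \<otimes> inv g)" if "s \<in> S" for s
  proof (rule conj_commute)
    have "inv g \<otimes> s \<otimes> g \<in> S" using conj[of "inv g" s] g that by simp
    then show "a \<otimes> (inv g \<otimes> s \<otimes> g) = (inv g \<otimes> s \<otimes> g) \<otimes> a"
      using a by (auto simp: centralizer_def)
  qed (use g a S that in \<open>auto simp: centralizer_def\<close>)
  then show "g \<otimes> a \<otimes> inv g \<in> centralizer G S"
    using g a by (auto simp: centralizer_def)
qed

lemma commutator_eq_one_iff:
  assumes "u \<in> carrier G" "v \<in> carrier G"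
  shows "commutator G u v = \<one> \<longleftrightarrow> u \<otimes> v = v \<otimes> u"
proof -
  have "commutator G u v = (u \<otimes> v) \<otimes> inv (v \<otimes> u)"
    using assms by (simp add: commutator_def inv_mult_group m_assoc)
  then show ?thesis
    using assms by (metis inv_closed inv_equality inv_inv m_closed r_inv)
qed

end

section \<open>Gromov products and coarse centres\<close>

locale gromov_hyperbolic = Metric_space M d for M :: "'b set" and d +
  fixes \<delta> :: real
  assumes hyperbolic: "\<lbrakk>w \<in> M; x \<in> M; y \<in> M; z \<in> M\<rbrakk> \<Longrightarrow>
    min (gromov_product d w x y) (gromov_product d w y z) - \<delta> \<le> gromov_product d w x z"
begin

lemma product_commute: "gromov_product d w x y = gromov_product d w y x"
  by (simp add: gromov_product_def commute)

text \<open>Doubling the hyperbolicity inequality and cancelling turns it into a comparison of the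
  three sums over opposite pairs of points.\<close>

lemma four_point:
  assumes "w \<in> M" "x \<in> M" "y \<in> M" "z \<in> M"
  shows "d x z + d y w \<le> max (d x y + d z w) (d y z + d x w) + 2 * \<delta>"
  using hyperbolic[OF assms] unfolding gromov_product_def min_def max_def
  by (auto split: if_splits simp: field_simps)

text \<open>Were the last product larger, going from \<open>x\<close> via \<open>x'\<close> to
  \<open>y'\<close> and then via \<open>y'\<close> to \<open>y\<close> would lose one \<delta> each
  time and leave \<open>x\<close> and \<open>y\<close> with a product above
  \<open>K\<close>.\<close>

lemma product_chain:
  assumes "w \<in> M" "x \<in> M" "x' \<in> M" "y \<in> M" "y' \<in> M"
    and "gromov_product d w x y \<le> K"
    and "gromov_product d w x x' > K + 2 * \<delta>" "gromov_product d w y y' > K + 2 * \<delta>" "\<delta> \<ge> 0"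
  shows "gromov_product d w x' y' \<le> K + 2 * \<delta>"
proof (rule ccontr)
  assume "\<not> ?thesis"
  then have "gromov_product d w x y' > K + \<delta>"
    using hyperbolic[of w x x' y'] assms by (auto simp: min_def split: if_splits)
  then show False
    using hyperbolic[of w x y' y] assms product_commute[of w y y'] by (auto simp: min_def split: if_splits)
qed

text \<open>At \<open>p\<close>, hyperbolicity lets at most one of \<open>x\<close>,
  \<open>y\<close>, \<open>z\<close> have a product with \<open>q\<close> above
  \<open>K + \<delta>\<close>; likewise at \<open>q\<close> for products with \<open>p\<close>. So
  one of the three is good at both points, and its two products add up to
  \<open>d p q\<close>.\<close>

lemma tripod_center:
  assumes M: "p \<in> M" "q \<in> M" "x \<in> M" "y \<in> M" "z \<in> M"
    and p: "gromov_product d p x y \<le> K" "gromov_product d p x z \<le> K" "gromov_product d p y z \<le> K"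
    and q: "gromov_product d q x y \<le> K" "gromov_product d q x z \<le> K" "gromov_product d q y z \<le> K"
  shows "d p q \<le> 2 * K + 2 * \<delta>"
proof -
  have one: "min (gromov_product d u s v) (gromov_product d u t v) \<le> K + \<delta>"
    if "gromov_product d u s t \<le> K" "u \<in> M" "v \<in> M" "s \<in> M" "t \<in> M" for u v s t
    using hyperbolic[of u s v t] that product_commute[of u v t] by simp
  have sum: "gromov_product d p s q + gromov_product d q s p = d p q" for s
    using commute[of p q] by (simp add: gromov_product_def field_simps)
  show ?thesis
    using one[OF p(1), of q] one[OF p(2), of q] one[OF p(3), of q]
      one[OF q(1), of p] one[OF q(2), of p] one[OF q(3), of p]
      sum[of x] sum[of y] sum[of z] M
    unfolding min_def by (auto split: if_splits)
qed

text \<open>Distinct limits only provide pairs with small product arbitrarily far out. One such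
  pair, far enough along both sequences, bounds the whole tails through
  \<open>product_chain\<close>.\<close>

lemma separated_limits:
  assumes "\<delta> \<ge> 0" and M: "p \<in> M" "\<And>n. a n \<in> M" "\<And>n. b n \<in> M"
    and a: "converges_at_infinity d p a" and b: "converges_at_infinity d p b"
    and "\<not> same_boundary_point d p a b"
  obtains K n0 where "\<And>m n. m \<ge> n0 \<Longrightarrow> n \<ge> n0 \<Longrightarrow> gromov_product d p (a m) (b n) \<le> K"
proof -
  obtain K where K: "\<And>N0. \<exists>m\<ge>N0. \<exists>n\<ge>N0. gromov_product d p (a m) (b n) < K"
    using assms(7) unfolding same_boundary_point_def by (meson not_le)
  \<comment> \<open>The extra 1 supplies the strict inequalities that \<open>product_chain\<close>
    demands.\<close>
  obtain n1 where n1: "\<And>m n. m \<ge> n1 \<Longrightarrow> n \<ge> n1 \<Longrightarrow> gromov_product d p (a m) (a n) \<ge> K + 2 * \<delta> + 1"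
    using a unfolding converges_at_infinity_def by blast
  obtain n2 where n2: "\<And>m n. m \<ge> n2 \<Longrightarrow> n \<ge> n2 \<Longrightarrow> gromov_product d p (b m) (b n) \<ge> K + 2 * \<delta> + 1"
    using b unfolding converges_at_infinity_def by blast
  obtain i j where ij: "i \<ge> max n1 n2" "j \<ge> max n1 n2" "gromov_product d p (a i) (b j) < K"
    using K by blast
  show thesis
  proof (rule that[of "max n1 n2" "K + 2 * \<delta>"])
    fix m n assume "m \<ge> max n1 n2" "n \<ge> max n1 n2"
    then show "gromov_product d p (a m) (b n) \<le> K + 2 * \<delta>"
      using n1[of i m] n2[of j n] ij M assms(1)
      by (intro product_chain[of p "a i" "a m" "b j" "b n" K]) auto
  qed
qed

end

section \<open>Displacements under acylindrical actions\<close>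

locale acylindrical_hyperbolic = group G + gromov_hyperbolic M d \<delta>
  for G :: "('a, 'm) monoid_scheme" (structure) and M :: "'b set" and d \<delta> +
  fixes \<phi> :: "'a \<Rightarrow> 'b \<Rightarrow> 'b"
  assumes delta_nonneg: "\<delta> \<ge> 0"
    and action: "isometric_action G M d \<phi>"
    and acylindrical: "acylindrical_action G M d \<phi>"
begin

lemma act_closed [simp]: "g \<in> carrier G \<Longrightarrow> x \<in> M \<Longrightarrow> \<phi> g x \<in> M"
  using action unfolding isometric_action_def by blast

lemma act_isometry [simp]:
  "g \<in> carrier G \<Longrightarrow> x \<in> M \<Longrightarrow> y \<in> M \<Longrightarrow> d (\<phi> g x) (\<phi> g y) = d x y"
  using action unfolding isometric_action_def by blast

lemma act_one [simp]: "x \<in> M \<Longrightarrow> \<phi> \<one> x = x"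
  using action unfolding isometric_action_def by blast

lemma act_mult [simp]:
  "g \<in> carrier G \<Longrightarrow> h \<in> carrier G \<Longrightarrow> x \<in> M \<Longrightarrow> \<phi> (g \<otimes> h) x = \<phi> g (\<phi> h x)"
  using action unfolding isometric_action_def by blast

lemma act_inv_left:
  assumes "g \<in> carrier G" "x \<in> M" "y \<in> M"
  shows "d (\<phi> (inv g) x) y = d x (\<phi> g y)"
proof -
  have "d x (\<phi> g y) = d (\<phi> g (\<phi> (inv g) x)) (\<phi> g y)"
    using assms act_mult[of g "inv g" x] by (simp del: act_mult)
  then show ?thesis using assms by simp
qed

text \<open>By normality, a bound on the displacement of \<open>p\<close> under \<open>N\<close>
  also holds at every \<open>\<phi> g p\<close>. With \<open>\<phi> g p\<close> far away,
  acylindricity makes \<open>N\<close> finite.\<close>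

lemma infinite_normal_unbounded:
  assumes N: "N \<lhd> G" "infinite N" and p: "p \<in> M"
    and orbit: "\<And>R. \<exists>g\<in>carrier G. d p (\<phi> g p) \<ge> R"
  shows "\<exists>m\<in>N. d p (\<phi> m p) > C"
proof (rule ccontr)
  assume "\<not> ?thesis"
  \<comment> \<open>Acylindricity requires a positive bound, hence \<open>max C 1\<close>.\<close>
  then have C: "d p (\<phi> m p) \<le> max C 1" if "m \<in> N" for m
    using that by (meson le_max_iff_disj not_le)
  have "max C 1 > 0" by simp
  then obtain R where R: "\<And>x y. x \<in> M \<Longrightarrow> y \<in> M \<Longrightarrow> d x y \<ge> R \<Longrightarrow>
      finite {g \<in> carrier G. d x (\<phi> g x) \<le> max C 1 \<and> d y (\<phi> g y) \<le> max C 1}"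
    using acylindrical unfolding acylindrical_action_def by meson
  obtain g where g: "g \<in> carrier G" "d p (\<phi> g p) \<ge> R" using orbit by blast
  have "N \<subseteq> {h \<in> carrier G. d p (\<phi> h p) \<le> max C 1 \<and> d (\<phi> g p) (\<phi> h (\<phi> g p)) \<le> max C 1}"
  proof
    fix m assume m: "m \<in> N"
    have mG: "m \<in> carrier G" using N(1) m by (meson normal_imp_subgroup subgroup.mem_carrier)
    have "inv g \<otimes> m \<otimes> g \<in> N"
      using N(1) g m by (simp add: normal.inv_op_closed1)
    then have "d p (\<phi> (inv g \<otimes> m \<otimes> g) p) \<le> max C 1" by (rule C)
    then have "d (\<phi> g p) (\<phi> m (\<phi> g p)) \<le> max C 1"
      using mG g p act_inv_left[of g "\<phi> m (\<phi> g p)" p] by (simp add: commute)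
    then show "m \<in> {h \<in> carrier G. d p (\<phi> h p) \<le> max C 1 \<and> d (\<phi> g p) (\<phi> h (\<phi> g p)) \<le> max C 1}"
      using mG C[OF m] by simp
  qed
  then show False using R[of p "\<phi> g p"] g p N(2) finite_subset by auto
qed

lemma orbit_commuting:
  assumes "n \<in> carrier G" "m \<in> carrier G" "n \<otimes> m = m \<otimes> n" "p \<in> M"
  shows "d (\<phi> n p) (\<phi> m (\<phi> n p)) = d p (\<phi> m p)"
proof -
  have "\<phi> m (\<phi> n p) = \<phi> n (\<phi> m p)"
    using assms by (metis act_mult)
  then show ?thesis using assms by simp
qed

text \<open>An element commuting with \<open>m\<close> moves \<open>\<phi> m p\<close> exactly as
  far as \<open>p\<close>. For a far-moving \<open>m\<close> in \<open>C\<close>, acylindricity at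
  \<open>p\<close> and \<open>\<phi> m p\<close> gives a bound \<open>k\<close> independent of
  \<open>F\<close>.\<close>

lemma commuting_small_displacement:
  assumes C: "C \<subseteq> carrier G" "\<And>R. \<exists>m\<in>C. d p (\<phi> m p) \<ge> R" and p: "p \<in> M" and "\<epsilon> > 0"
  obtains k :: nat where "\<And>F. F \<subseteq> centralizer G C \<Longrightarrow>
      (\<And>n. n \<in> F \<Longrightarrow> d p (\<phi> n p) \<le> \<epsilon>) \<Longrightarrow> finite F \<and> card F \<le> k"
proof -
  obtain R k where R: "\<And>x y. x \<in> M \<Longrightarrow> y \<in> M \<Longrightarrow> d x y \<ge> R \<Longrightarrow>
      finite {g \<in> carrier G. d x (\<phi> g x) \<le> \<epsilon> \<and> d y (\<phi> g y) \<le> \<epsilon>} \<and>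
      card {g \<in> carrier G. d x (\<phi> g x) \<le> \<epsilon> \<and> d y (\<phi> g y) \<le> \<epsilon>} \<le> k"
    using acylindrical \<open>\<epsilon> > 0\<close> unfolding acylindrical_action_def by meson
  obtain m where m: "m \<in> C" "d p (\<phi> m p) \<ge> R" using C by blast
  let ?A = "{g \<in> carrier G. d p (\<phi> g p) \<le> \<epsilon> \<and> d (\<phi> m p) (\<phi> g (\<phi> m p)) \<le> \<epsilon>}"
  have A: "finite ?A" "card ?A \<le> k" using R[of p "\<phi> m p"] m C p by auto
  show thesis
  proof (rule that)
    fix F assume F: "F \<subseteq> centralizer G C" "\<And>n. n \<in> F \<Longrightarrow> d p (\<phi> n p) \<le> \<epsilon>"
    have "F \<subseteq> ?A"
    proof
      fix n assume n: "n \<in> F"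
      then have "n \<in> carrier G" "m \<otimes> n = n \<otimes> m"
        using F m unfolding centralizer_def by auto
      then show "n \<in> ?A" using F(2)[OF n] orbit_commuting[of m n p] m C p by auto
    qed
    then show "finite F \<and> card F \<le> k"
      using A by (meson card_mono finite_subset le_trans)
  qed
qed

text \<open>If neither \<open>g n g\<inverse>\<close> nor \<open>g n\<inverse> g\<inverse>\<close> moves \<open>p\<close> in the direction of \<open>g p\<close>, then both \<open>n\<close> and
  \<open>n\<inverse>\<close> push \<open>q = g\<inverse> p\<close> away from \<open>p\<close>; the four-point inequality for \<open>p, n p, q, n q\<close> only allows
  this if \<open>n\<close> almost fixes \<open>q\<close>.\<close>
lemma conjugate_direction:
  assumes g: "g \<in> carrier G" and n: "n \<in> carrier G" and p: "p \<in> M"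
    and far: "d p (\<phi> g p) \<ge> d p (\<phi> n p) + K"
    and 1: "gromov_product d p (\<phi> g p) (\<phi> (g \<otimes> n \<otimes> inv g) p) < K"
    and 2: "gromov_product d p (\<phi> g p) (\<phi> (g \<otimes> inv n \<otimes> inv g) p) < K"
  shows "d p (\<phi> (g \<otimes> n \<otimes> inv g) p) \<le> 2 * K + \<delta>"
proof -
  define q where "q = \<phi> (inv g) p"
  have q: "q \<in> M" using g p by (simp add: q_def)
  have gq: "\<phi> g q = p" 
    using g p act_mult[of g "inv g" p] by (simp add: q_def del: act_mult)
  have conj: "\<phi> (g \<otimes> h \<otimes> inv g) p = \<phi> g (\<phi> h q)" if "h \<in> carrier G" for h
    using that g p by (simp add: q_def)
  have disp: "d p (\<phi> g (\<phi> h q)) = d q (\<phi> h q)" if "h \<in> carrier G" for h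
    using that g q gq act_isometry[of g q "\<phi> h q"] by simp
  have D: "d p (\<phi> g p) = d p q"
    using act_inv_left[of g p p] g p by (simp add: q_def commute)
  \<comment> \<open>Translating by \<open>inv g\<close> turns the product in the hypothesis into one
    based at \<open>q\<close>, between \<open>p\<close> and \<open>\<phi> n q\<close>.\<close>
  have e1: "d p (\<phi> n q) > d p q + d q (\<phi> n q) - 2 * K"
    using 1 D disp[OF n] act_isometry[of g p "\<phi> n q"] n g p q unfolding conj[OF n]
    by (simp add: gromov_product_def commute[of _ p] field_simps)
  have "d p (\<phi> (inv n) q) > d p q + d q (\<phi> (inv n) q) - 2 * K"
    using 2 D disp[of "inv n"] act_isometry[of g p "\<phi> (inv n) q"] n g p q unfolding conj[OF inv_closed[OF n]]
    by (simp add: gromov_product_def commute[of _ p] field_simps)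
  then have e2: "d q (\<phi> n p) > d p q + d q (\<phi> n q) - 2 * K"
    using act_inv_left[of n q p] act_inv_left[of n q q] n p q by (simp add: commute)
  have t: "d p (\<phi> n q) \<le> d p (\<phi> n p) + d p q"
    using triangle[of p "\<phi> n p" "\<phi> n q"] n p q by simp
  have "d p (\<phi> n q) + d q (\<phi> n p) \<le> max (d p q + d (\<phi> n q) (\<phi> n p)) (d q (\<phi> n q) + d p (\<phi> n p)) + 2 * \<delta>"
    using four_point[of "\<phi> n p" p q "\<phi> n q"] n p q by simp
  \<comment> \<open>In the first branch of the maximum the terms \<open>d p q\<close> cancel. In the
    second, \<open>far\<close> bounds \<open>d q (\<phi> n q)\<close> by
    \<open>2 * K + 2 * \<delta> - d p (\<phi> n p)\<close>, while \<open>e1\<close> and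
    \<open>t\<close> bound it by \<open>2 * K + d p (\<phi> n p)\<close>; the average is the
    claim.\<close>
  then have "d q (\<phi> n q) \<le> 2 * K + \<delta>"
    using e1 e2 t far D n p q by (auto simp: max_def commute split: if_splits)
  then show ?thesis using conj disp n by simp
qed

text \<open>If no element of \<open>N\<close> points towards \<open>\<phi> g p\<close>, then
  \<open>conjugate_direction\<close> makes all conjugates by \<open>g\<close> of a fixed finite
  subset of \<open>N\<close> move \<open>p\<close> little. A subset larger than the bound of
  \<open>commuting_small_displacement\<close> excludes this.\<close>

lemma normal_reaches_direction:
  assumes N: "N \<lhd> G" "infinite N" and C: "C \<subseteq> carrier G" "\<And>R. \<exists>m\<in>C. d p (\<phi> m p) \<ge> R"
    and NC: "N \<subseteq> centralizer G C" and p: "p \<in> M" and "K > 0"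
  obtains D where "\<And>g. g \<in> carrier G \<Longrightarrow> d p (\<phi> g p) \<ge> D \<Longrightarrow>
    \<exists>n\<in>N. gromov_product d p (\<phi> g p) (\<phi> n p) \<ge> K"
proof -
  have NG: "N \<subseteq> carrier G" using N(1) by (simp add: normal_imp_subgroup subgroup.subset)
  have "2 * K + \<delta> > 0" using \<open>K > 0\<close> delta_nonneg by simp
  then obtain k :: nat where k: "\<And>F. F \<subseteq> centralizer G C \<Longrightarrow>
      (\<And>n. n \<in> F \<Longrightarrow> d p (\<phi> n p) \<le> 2 * K + \<delta>) \<Longrightarrow> finite F \<and> card F \<le> k"
    using commuting_small_displacement[OF C p] by metis
  obtain F where F: "F \<subseteq> N" "finite F" "card F = Suc k"
    using infinite_arbitrarily_large[OF N(2)] by blast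
  obtain B where B: "\<And>n. n \<in> F \<Longrightarrow> d p (\<phi> n p) \<le> B"
    using bdd_above_finite[of "(\<lambda>n. d p (\<phi> n p)) ` F"] F(2) unfolding bdd_above_def by auto
  show thesis
  \<comment> \<open>This threshold meets the distance hypothesis of
    \<open>conjugate_direction\<close> for all of \<open>F\<close> at once.\<close>
  proof (rule that[of "B + K"], rule ccontr)
    fix g assume g: "g \<in> carrier G" "d p (\<phi> g p) \<ge> B + K"
      and no: "\<not> (\<exists>n\<in>N. gromov_product d p (\<phi> g p) (\<phi> n p) \<ge> K)"
    define F' where "F' = (\<lambda>n. g \<otimes> n \<otimes> inv g) ` F"
    have conj: "g \<otimes> n \<otimes> inv g \<in> N" if "n \<in> N" for n
      using N(1) g that by (simp add: normal.inv_op_closed2)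
    have sub: "F' \<subseteq> N" using F conj by (auto simp: F'_def)
    have "d p (\<phi> (g \<otimes> n \<otimes> inv g) p) \<le> 2 * K + \<delta>" if "n \<in> F" for n
    proof (rule conjugate_direction)
      have n: "n \<in> N" "inv n \<in> N"
        using that F N(1) by (auto simp: normal_imp_subgroup subgroup.m_inv_closed)
      show "n \<in> carrier G" using n NG by auto
      show "d p (\<phi> n p) + K \<le> d p (\<phi> g p)" using B[OF that] g by simp
      show "gromov_product d p (\<phi> g p) (\<phi> (g \<otimes> n \<otimes> inv g) p) < K"
        "gromov_product d p (\<phi> g p) (\<phi> (g \<otimes> inv n \<otimes> inv g) p) < K"
        using no conj n by (meson not_le)+
    qed (use g p in auto)
    then have "card F' \<le> k" using k[of F'] sub NC by (auto simp: F'_def)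
    moreover have "card F' = card F" unfolding F'_def
      by (rule card_image) (use F NG g in \<open>auto simp: inj_on_def subset_iff\<close>)
    ultimately show False using F by simp
  qed
qed

text \<open>Both \<open>p\<close> and \<open>\<phi> m p\<close> are coarse centres of the three
  orbit points: \<open>m\<close> carries the triple to one that is close to it compared with its
  distance from \<open>p\<close>. Then \<open>tripod_center\<close> applies with
  \<open>K + 2 * \<delta>\<close>.\<close>

lemma commuting_tripod_displacement:
  assumes m: "m \<in> carrier G" and p: "p \<in> M"
    and n: "n1 \<in> carrier G" "n2 \<in> carrier G" "n3 \<in> carrier G"
    and nm: "n1 \<otimes> m = m \<otimes> n1" "n2 \<otimes> m = m \<otimes> n2" "n3 \<otimes> m = m \<otimes> n3"
    and far: "d p (\<phi> n1 p) > L" "d p (\<phi> n2 p) > L" "d p (\<phi> n3 p) > L"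
    and L: "L \<ge> K + 2 * \<delta> + d p (\<phi> m p)"
    and K: "gromov_product d p (\<phi> n1 p) (\<phi> n2 p) \<le> K" "gromov_product d p (\<phi> n1 p) (\<phi> n3 p) \<le> K"
      "gromov_product d p (\<phi> n2 p) (\<phi> n3 p) \<le> K"
  shows "d p (\<phi> m p) \<le> 2 * K + 6 * \<delta>"
proof -
  have near: "gromov_product d (\<phi> m p) (\<phi> m (\<phi> n p)) (\<phi> n p) > K + 2 * \<delta>"
    if "n \<in> carrier G" "n \<otimes> m = m \<otimes> n" "d p (\<phi> n p) > L" for n
  proof -
    have "d (\<phi> m (\<phi> n p)) (\<phi> n p) = d p (\<phi> m p)"
      using orbit_commuting[of n m p] that m p by (simp add: commute)
    moreover have "d (\<phi> n p) (\<phi> m p) \<ge> d p (\<phi> n p) - d p (\<phi> m p)"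
      using triangle[of p "\<phi> m p" "\<phi> n p"] that m p by (simp add: commute)
    ultimately show ?thesis
      using that m p L by (simp add: gromov_product_def commute)
  qed
  have move: "gromov_product d (\<phi> m p) (\<phi> n p) (\<phi> n' p) \<le> K + 2 * \<delta>"
    if "n \<in> carrier G" "n \<otimes> m = m \<otimes> n" "d p (\<phi> n p) > L"
      "n' \<in> carrier G" "n' \<otimes> m = m \<otimes> n'" "d p (\<phi> n' p) > L"
      "gromov_product d p (\<phi> n p) (\<phi> n' p) \<le> K" for n n'
  proof (rule product_chain)
    show "gromov_product d (\<phi> m p) (\<phi> m (\<phi> n p)) (\<phi> m (\<phi> n' p)) \<le> K"
      using that m p by (simp add: gromov_product_def)
  qed (use that near m p delta_nonneg in auto)
  have "d p (\<phi> m p) \<le> 2 * (K + 2 * \<delta>) + 2 * \<delta>"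
    by (rule tripod_center[of _ _ "\<phi> n1 p" "\<phi> n2 p" "\<phi> n3 p"])
      (use K n nm far m p delta_nonneg move in auto)
  then show ?thesis by simp
qed

section \<open>Contradiction from two commuting infinite normal subgroups\<close>

lemma commuting_normal_subgroups_finite:
  assumes nonel: "nonelementary_action G M d \<phi>"
    and N: "N \<lhd> G" "infinite N" and C: "C \<lhd> G" "infinite C" and NC: "N \<subseteq> centralizer G C"
  shows False
proof -
  have NG: "N \<subseteq> carrier G" and CG: "C \<subseteq> carrier G"
    using N(1) C(1) by (simp_all add: normal_imp_subgroup subgroup.subset)
  obtain p a b c where p: "p \<in> M"
    and abc: "range a \<subseteq> carrier G" "range b \<subseteq> carrier G" "range c \<subseteq> carrier G"
    and conv: "converges_at_infinity d p (\<lambda>n. \<phi> (a n) p)"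
        "converges_at_infinity d p (\<lambda>n. \<phi> (b n) p)" "converges_at_infinity d p (\<lambda>n. \<phi> (c n) p)"
    and sep: "\<not> same_boundary_point d p (\<lambda>n. \<phi> (a n) p) (\<lambda>n. \<phi> (b n) p)"
        "\<not> same_boundary_point d p (\<lambda>n. \<phi> (a n) p) (\<lambda>n. \<phi> (c n) p)"
        "\<not> same_boundary_point d p (\<lambda>n. \<phi> (b n) p) (\<lambda>n. \<phi> (c n) p)"
    using nonel unfolding nonelementary_action_def by blast
  have abcG: "a n \<in> carrier G" "b n \<in> carrier G" "c n \<in> carrier G" for n using abc by auto
  have far: "\<exists>n0. \<forall>n\<ge>n0. d p (\<phi> (s n) p) \<ge> R"
    if "converges_at_infinity d p (\<lambda>n. \<phi> (s n) p)" "\<And>n. s n \<in> carrier G" for s R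
  proof -
    \<comment> \<open>Diagonal products are distances, so convergence at infinity forces the
      sequence away from \<open>p\<close>.\<close>
    have "gromov_product d p (\<phi> (s n) p) (\<phi> (s n) p) = d p (\<phi> (s n) p)" for n
      using that p by (simp add: gromov_product_def commute)
    then show ?thesis using that unfolding converges_at_infinity_def by (metis order_refl)
  qed
  have unbdd: "\<exists>m\<in>C. d p (\<phi> m p) > R" for R
    using infinite_normal_unbounded[OF C p] far[OF conv(1)] abcG by (metis order_refl)
  then have unbdd': "\<exists>m\<in>C. d p (\<phi> m p) \<ge> R" for R by (meson less_imp_le)
  obtain K1 n1 where 1: "\<And>m n. m \<ge> n1 \<Longrightarrow> n \<ge> n1 \<Longrightarrow> gromov_product d p (\<phi> (a m) p) (\<phi> (b n) p) \<le> K1"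
    using separated_limits[OF delta_nonneg p _ _ conv(1,2) sep(1)] abcG p act_closed by metis
  obtain K2 n2 where 2: "\<And>m n. m \<ge> n2 \<Longrightarrow> n \<ge> n2 \<Longrightarrow> gromov_product d p (\<phi> (a m) p) (\<phi> (c n) p) \<le> K2"
    using separated_limits[OF delta_nonneg p _ _ conv(1,3) sep(2)] abcG p act_closed by metis
  obtain K3 n3 where 3: "\<And>m n. m \<ge> n3 \<Longrightarrow> n \<ge> n3 \<Longrightarrow> gromov_product d p (\<phi> (b m) p) (\<phi> (c n) p) \<le> K3"
    using separated_limits[OF delta_nonneg p _ _ conv(2,3) sep(3)] abcG p act_closed by metis
  define K where "K = max 0 (max K1 (max K2 K3))"
  have K: "K \<ge> 0" "K1 \<le> K" "K2 \<le> K" "K3 \<le> K" by (auto simp: K_def)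
  \<comment> \<open>The bound is that of \<open>commuting_tripod_displacement\<close> for
    \<open>K + 2 * \<delta>\<close>. It does not depend on \<open>m\<close>, so \<open>m\<close> can
    be fixed before \<open>L\<close> and the points approaching the limits.\<close>
  obtain m where m: "m \<in> C" "d p (\<phi> m p) > 2 * (K + 2 * \<delta>) + 6 * \<delta>" using unbdd by blast
  define L where "L = K + 4 * \<delta> + d p (\<phi> m p)"
  have L: "L + 1 > 0" "L \<ge> K + 2 * \<delta>" "L = (K + 2 * \<delta>) + 2 * \<delta> + d p (\<phi> m p)"
    using K delta_nonneg by (auto simp: L_def add_nonneg_pos)
  obtain D where D: "\<And>g. g \<in> carrier G \<Longrightarrow> d p (\<phi> g p) \<ge> D \<Longrightarrow>
      \<exists>n\<in>N. gromov_product d p (\<phi> g p) (\<phi> n p) \<ge> L + 1"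
    using normal_reaches_direction[OF N CG unbdd' NC p L(1)] by metis
  have pick: "\<exists>i\<ge>n0. \<exists>n\<in>N. gromov_product d p (\<phi> (s i) p) (\<phi> n p) \<ge> L + 1"
    if s: "converges_at_infinity d p (\<lambda>n. \<phi> (s n) p)" "\<And>n. s n \<in> carrier G" for s and n0 :: nat
  proof -
    obtain n1 where "\<And>n. n \<ge> n1 \<Longrightarrow> d p (\<phi> (s n) p) \<ge> D" using far[OF s] by blast
    then show ?thesis using D[of "s (max n0 n1)"] s(2) by (meson max.cobounded1 max.cobounded2)
  qed
  \<comment> \<open>Beyond this index all three separation bounds hold, and
    \<open>product_chain\<close> passes them on to \<open>u\<close>, \<open>v\<close>,
    \<open>w\<close>.\<close>
  let ?n0 = "max n1 (max n2 n3)"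
  obtain i u where u: "i \<ge> ?n0" "u \<in> N" "gromov_product d p (\<phi> (a i) p) (\<phi> u p) \<ge> L + 1"
    using pick[OF conv(1)] abcG by blast
  obtain j v where v: "j \<ge> ?n0" "v \<in> N" "gromov_product d p (\<phi> (b j) p) (\<phi> v p) \<ge> L + 1"
    using pick[OF conv(2)] abcG by blast
  obtain k w where w: "k \<ge> ?n0" "w \<in> N" "gromov_product d p (\<phi> (c k) p) (\<phi> w p) \<ge> L + 1"
    using pick[OF conv(3)] abcG by blast
  have G: "u \<in> carrier G" "v \<in> carrier G" "w \<in> carrier G" "m \<in> carrier G"
    using u v w m NG CG by auto
  have le: "gromov_product d p x y \<le> d p y" if "x \<in> M" "y \<in> M" for x y
    using triangle[of x y p] that p by (simp add: gromov_product_def commute)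
  have uvw: "gromov_product d p (\<phi> (a i) p) (\<phi> u p) > K + 2 * \<delta>"
    "gromov_product d p (\<phi> (b j) p) (\<phi> v p) > K + 2 * \<delta>"
    "gromov_product d p (\<phi> (c k) p) (\<phi> w p) > K + 2 * \<delta>"
    using u(3) v(3) w(3) L(2) by linarith+
  have "d p (\<phi> m p) \<le> 2 * (K + 2 * \<delta>) + 6 * \<delta>"
  proof (rule commuting_tripod_displacement[of m p u v w L])
    show "u \<otimes> m = m \<otimes> u" "v \<otimes> m = m \<otimes> v" "w \<otimes> m = m \<otimes> w"
      using u v w m NC by (auto simp: centralizer_def)
    show "d p (\<phi> u p) > L" "d p (\<phi> v p) > L" "d p (\<phi> w p) > L"
      using u(3) v(3) w(3) le[of "\<phi> (a i) p" "\<phi> u p"] le[of "\<phi> (b j) p" "\<phi> v p"]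
        le[of "\<phi> (c k) p" "\<phi> w p"] G abcG p by auto
    show "gromov_product d p (\<phi> u p) (\<phi> v p) \<le> K + 2 * \<delta>"
      by (rule product_chain[of _ "\<phi> (a i) p" _ "\<phi> (b j) p"])
        (use 1[of i j] u v K uvw G abcG p delta_nonneg in auto)
    show "gromov_product d p (\<phi> u p) (\<phi> w p) \<le> K + 2 * \<delta>"
      by (rule product_chain[of _ "\<phi> (a i) p" _ "\<phi> (c k) p"])
        (use 2[of i k] u w K uvw G abcG p delta_nonneg in auto)
    show "gromov_product d p (\<phi> v p) (\<phi> w p) \<le> K + 2 * \<delta>"
      by (rule product_chain[of _ "\<phi> (b j) p" _ "\<phi> (c k) p"])
        (use 3[of j k] v w K uvw G abcG p delta_nonneg in auto)
  qed (use G p L in auto)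
  then show False using m by simp
qed

end

theorem theorem1p3:
  fixes G :: "'a monoid"
  assumes "group G"
    and "\<exists>(M :: 'b set) d \<phi>. acyl_hyp_action G M d \<phi>"
    and "no_nontrivial_finite_normal G"
  shows "is_domain_group G"
  unfolding is_domain_group_def
proof (intro ballI impI, rule ccontr)
  interpret group G by fact
  fix x y
  assume x: "x \<in> carrier G" "x \<noteq> \<one>\<^bsub>G\<^esub>" and y: "y \<in> carrier G" "y \<noteq> \<one>\<^bsub>G\<^esub>"
    and "\<not> (\<exists>g\<in>carrier G. commutator G x (g \<otimes>\<^bsub>G\<^esub> y \<otimes>\<^bsub>G\<^esub> inv\<^bsub>G\<^esub> g) \<noteq> \<one>\<^bsub>G\<^esub>)"
  then have comm: "x \<otimes>\<^bsub>G\<^esub> (g \<otimes>\<^bsub>G\<^esub> y \<otimes>\<^bsub>G\<^esub> inv\<^bsub>G\<^esub> g) = (g \<otimes>\<^bsub>G\<^esub> y \<otimes>\<^bsub>G\<^esub> inv\<^bsub>G\<^esub> g) \<otimes>\<^bsub>G\<^esub> x"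
    if "g \<in> carrier G" for g
    using that commutator_eq_one_iff[of x "g \<otimes>\<^bsub>G\<^esub> y \<otimes>\<^bsub>G\<^esub> inv\<^bsub>G\<^esub> g"] by auto
  define S where "S = (\<lambda>g. g \<otimes>\<^bsub>G\<^esub> y \<otimes>\<^bsub>G\<^esub> inv\<^bsub>G\<^esub> g) ` carrier G"
  define C where "C = centralizer G S"
  \<comment> \<open>The double centralizer contains \<open>y\<close> and commutes with
    \<open>C\<close> by construction, so it can replace the normal closure of
    \<open>y\<close>.\<close>
  define N where "N = centralizer G C"
  have S: "S \<subseteq> carrier G" using y by (auto simp: S_def)
  have C: "C \<lhd> G" unfolding C_def
  proof (rule centralizer_normal[OF S])
    fix g s assume g: "g \<in> carrier G" and "s \<in> S"
    then obtain h where h: "h \<in> carrier G" "s = h \<otimes>\<^bsub>G\<^esub> y \<otimes>\<^bsub>G\<^esub> inv\<^bsub>G\<^esub> h" by (auto simp: S_def)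
    have "g \<otimes>\<^bsub>G\<^esub> s \<otimes>\<^bsub>G\<^esub> inv\<^bsub>G\<^esub> g = (g \<otimes>\<^bsub>G\<^esub> h) \<otimes>\<^bsub>G\<^esub> y \<otimes>\<^bsub>G\<^esub> inv\<^bsub>G\<^esub> (g \<otimes>\<^bsub>G\<^esub> h)"
      using g h y by (simp add: m_assoc inv_mult_group)
    then show "g \<otimes>\<^bsub>G\<^esub> s \<otimes>\<^bsub>G\<^esub> inv\<^bsub>G\<^esub> g \<in> S" using g h by (auto simp: S_def)
  qed
  have N: "N \<lhd> G" unfolding N_def
    by (rule centralizer_normal)
      (use C subgroup.subset[OF normal_imp_subgroup[OF C]] in \<open>auto simp: normal.inv_op_closed2\<close>)
  have "x \<in> C" using x comm by (auto simp: C_def centralizer_def S_def)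
  then have infC: "infinite C"
    using C x assms(3) unfolding no_nontrivial_finite_normal_def by blast
  have "y \<in> S" using y by (auto simp: S_def intro!: image_eqI[of _ _ "\<one>\<^bsub>G\<^esub>"])
  then have "y \<in> N" using y by (auto simp: N_def C_def centralizer_def)
  then have infN: "infinite N"
    using N y assms(3) unfolding no_nontrivial_finite_normal_def by blast
  obtain M :: "'b set" and d \<phi> where act: "acyl_hyp_action G M d \<phi>" using assms(2) by blast
  then obtain \<delta> where "\<delta> \<ge> 0" and hyp: "\<And>w x y z. w \<in> M \<Longrightarrow> x \<in> M \<Longrightarrow> y \<in> M \<Longrightarrow> z \<in> M \<Longrightarrow>
      gromov_product d w x z \<ge> min (gromov_product d w x y) (gromov_product d w y z) - \<delta>"
    unfolding acyl_hyp_action_def hyperbolic_space_def by blast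
  interpret Metric_space M d
    using act unfolding acyl_hyp_action_def hyperbolic_space_def geodesic_space_def by blast
  interpret acylindrical_hyperbolic G M d \<delta> \<phi>
    by unfold_locales (use act \<open>\<delta> \<ge> 0\<close> hyp in \<open>auto simp: acyl_hyp_action_def\<close>)
  show False
    using commuting_normal_subgroups_finite[OF _ N infN C infC] act
    by (auto simp: acyl_hyp_action_def N_def)
qed

end
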